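(* There is a family of unsatisfiable CNF formulas $\{F_n\}_{n=0}^\infty$, with $F_n$ having $\Theta(n)$ variables, such that $F_n$ has Monomial Calculus refutations of degree $2$, but every Nullstellensatz refutation of $F_n$ has degree at least $\lceil\log n\rceil$.
   Context: A CNF formula is refuted via its polynomial encoding over a field $\mathbb F$: a clause $\bigvee_{x\in P}x\vee\bigvee_{y\in N}\bar y$ becomes $\prod_{x\in P}(1-x)\prod_{y\in N}y$, and Boolean axioms $x_i^2-x_i$ are available. Nullstellensatz (NS): a refutation of $p_1,\dots,p_m\in\mathbb F[x_1,\dots,x_n]$ consists of polynomials $g_1,\dots,g_m,h_1,\dots,h_n$ with $\sum_j p_jg_j+\sum_i h_i(x_i^2-x_i)=1$; its degree is the maximum degree of the polynomials $p_jg_j$, $h_i(x_i^2-x_i)$ (equivalently, of a dynamic derivation using linear combinations and multiplication by variables applied only to products of a monomial and an axiom). Monomial Calculus (MC): a refutation of a set $\mathcal P$ is a sequence of polynomials ending in $1$, each in $\mathcal P$, a Boolean axiom, or obtained from earlier ones by linear combination $\alpha p+\beta q$ ($\alpha,\beta\in\mathbb F$) or by multiplication $p\mapsto x_ip$ where $p$ is a monomial or the product of a monomial and an axiom. Degree of an MC refutation: maximum degree of its polynomials. *)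

theory Defs
  imports Complex_Main "HOL-Library.Poly_Mapping" "HOL-Library.Landau_Symbols"
begin

text \<open>Variables are natural numbers. A pair \<open>(P, N)\<close> is the clause with positive
  literals \<open>x\<close> for \<open>x \<in> P\<close> and negative literals \<open>\<not> y\<close> for \<open>y \<in> N\<close>.\<close>

type_synonym clause = "nat set \<times> nat set"
type_synonym cnf = "clause set"

definition is_cnf :: "cnf \<Rightarrow> bool" where
  "is_cnf F \<longleftrightarrow> finite F \<and> (\<forall>(P, N) \<in> F. finite P \<and> finite N)"

definition cnf_vars :: "cnf \<Rightarrow> nat set" where
  "cnf_vars F = (\<Union>(P, N) \<in> F. P \<union> N)"

definition sat_clause :: "(nat \<Rightarrow> bool) \<Rightarrow> clause \<Rightarrow> bool" where
  "sat_clause \<tau> C \<longleftrightarrow> (\<exists>x \<in> fst C. \<tau> x) \<or> (\<exists>y \<in> snd C. \<not> \<tau> y)"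

definition unsatisfiable :: "cnf \<Rightarrow> bool" where
  "unsatisfiable F \<longleftrightarrow> \<not> (\<exists>\<tau>. \<forall>C \<in> F. sat_clause \<tau> C)"

text \<open>An exponent vector is a finitely supported map from variables to exponents; a polynomial
  is a finitely supported map from exponent vectors to coefficients. Multiplication on
  \<open>\<Rightarrow>\<^sub>0\<close> is convolution, hence polynomial multiplication.\<close>

type_synonym expo = "nat \<Rightarrow>\<^sub>0 nat"
type_synonym 'a mpoly = "expo \<Rightarrow>\<^sub>0 'a"

definition monomial :: "expo \<Rightarrow> 'a::comm_ring_1 mpoly" where
  "monomial m = Poly_Mapping.single m 1"

definition Var :: "nat \<Rightarrow> 'a::comm_ring_1 mpoly" where
  "Var i = monomial (Poly_Mapping.single i 1)"

definition Const :: "'a \<Rightarrow> 'a::comm_ring_1 mpoly" where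
  "Const c = Poly_Mapping.single 0 c"

definition polys_in :: "nat set \<Rightarrow> 'a::comm_ring_1 mpoly set" where
  "polys_in V = {p. \<forall>m \<in> Poly_Mapping.keys p. Poly_Mapping.keys m \<subseteq> V}"

definition expo_degree :: "expo \<Rightarrow> nat" where
  "expo_degree m = (\<Sum>i \<in> Poly_Mapping.keys m. Poly_Mapping.lookup m i)"

text \<open>Total degree; the zero polynomial has degree 0 by convention.\<close>

definition total_degree :: "'a::comm_ring_1 mpoly \<Rightarrow> nat" where
  "total_degree p = Max (insert 0 (expo_degree ` Poly_Mapping.keys p))"

definition enc_clause :: "clause \<Rightarrow> 'a::comm_ring_1 mpoly" where
  "enc_clause C = (\<Prod>x \<in> fst C. 1 - Var x) * (\<Prod>y \<in> snd C. Var y)"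

definition enc_cnf :: "cnf \<Rightarrow> 'a::comm_ring_1 mpoly set" where
  "enc_cnf F = enc_clause ` F"

definition bool_axiom :: "nat \<Rightarrow> 'a::comm_ring_1 mpoly" where
  "bool_axiom i = Var i ^ 2 - Var i"

text \<open>\<open>A\<close> is the finite set of polynomials to be refuted in the ring with the finite set of
  variables \<open>V\<close>; the multipliers are \<open>g p\<close> for \<open>p \<in> A\<close> and \<open>h i\<close> for \<open>i \<in> V\<close>.\<close>

definition ns_refutation ::
    "nat set \<Rightarrow> 'a::field mpoly set \<Rightarrow> ('a mpoly \<Rightarrow> 'a mpoly) \<Rightarrow> (nat \<Rightarrow> 'a mpoly) \<Rightarrow> bool" where
  "ns_refutation V A g h \<longleftrightarrow>
     (\<forall>p \<in> A. g p \<in> polys_in V) \<and> (\<forall>i \<in> V. h i \<in> polys_in V) \<and>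
     (\<Sum>p \<in> A. p * g p) + (\<Sum>i \<in> V. h i * bool_axiom i) = 1"

text \<open>For a refutation the set below is nonempty, since its elements sum to 1.\<close>

definition ns_degree ::
    "nat set \<Rightarrow> 'a::field mpoly set \<Rightarrow> ('a mpoly \<Rightarrow> 'a mpoly) \<Rightarrow> (nat \<Rightarrow> 'a mpoly) \<Rightarrow> nat" where
  "ns_degree V A g h =
     Max (total_degree ` ((\<lambda>p. p * g p) ` A \<union> (\<lambda>i. h i * bool_axiom i) ` V))"

definition mc_axioms :: "nat set \<Rightarrow> 'a::field mpoly set \<Rightarrow> 'a mpoly set" where
  "mc_axioms V A = A \<union> bool_axiom ` V"

definition mc_multipliable :: "nat set \<Rightarrow> 'a::field mpoly set \<Rightarrow> 'a mpoly \<Rightarrow> bool" where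
  "mc_multipliable V A p \<longleftrightarrow>
     (\<exists>m. Poly_Mapping.keys m \<subseteq> V \<and>
        (p = monomial m \<or> (\<exists>a \<in> mc_axioms V A. p = monomial m * a)))"

definition mc_refutation :: "nat set \<Rightarrow> 'a::field mpoly set \<Rightarrow> 'a mpoly list \<Rightarrow> bool" where
  "mc_refutation V A ps \<longleftrightarrow>
     ps \<noteq> [] \<and> last ps = 1 \<and>
     (\<forall>k < length ps.
        ps ! k \<in> mc_axioms V A \<or>
        (\<exists>i < k. \<exists>j < k. \<exists>\<alpha> \<beta>. ps ! k = Const \<alpha> * ps ! i + Const \<beta> * ps ! j) \<or>
        (\<exists>i < k. \<exists>v \<in> V. mc_multipliable V A (ps ! i) \<and> ps ! k = Var v * ps ! i))"

definition mc_degree :: "'a::field mpoly list \<Rightarrow> nat" where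
  "mc_degree ps = Max (total_degree ` set ps)"

end

theory Submission
  imports Defs
begin

text \<open>The formulas are the induction principles \<open>x\<^sub>1\<close>, \<open>x\<^sub>i \<longrightarrow> x\<^sub>i\<^sub>+\<^sub>1\<close>, \<open>\<not> x\<^sub>n\<^sub>+\<^sub>1\<close>. In Monomial Calculus
  the monomial \<open>x\<^sub>i\<^sub>+\<^sub>1\<close> yields \<open>x\<^sub>i x\<^sub>i\<^sub>+\<^sub>1\<close>, and adding the axiom \<open>x\<^sub>i (1 - x\<^sub>i\<^sub>+\<^sub>1)\<close> gives \<open>x\<^sub>i\<close>, down to \<open>1\<close>.

  For Nullstellensatz, let \<open>L\<close> be the linear functional sending a monomial to \<open>1\<close> if its set of
  variables is a configuration reachable from the empty one in the reversible pebble game on a path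
  with \<open>d\<close> pebbles, and to \<open>0\<close> otherwise. All axioms except the last are binomials, and their
  multiples of degree at most \<open>d\<close> are killed by \<open>L\<close> because the two monomials are related by one
  reversible move. With \<open>d\<close> pebbles only nodes below \<open>2\<^sup>d\<close> are reachable, so if \<open>n \<ge> 2\<^sup>d\<close> the
  multiples of \<open>x\<^sub>n\<^sub>+\<^sub>1\<close> are killed too, whereas \<open>L 1 = 1\<close>.\<close>

section \<open>The reversible pebble game on a path\<close>

text \<open>Configurations of the reversible pebble game on the path \<open>1, 2, \<dots>\<close> that can be reached
  with \<open>d\<close> pebbles; the virtual node \<open>0\<close> always counts as pebbled.\<close>

inductive reach :: "nat \<Rightarrow> nat set \<Rightarrow> bool" for d where
  reach_empty: "reach d {}"
| reach_place: "reach d S \<Longrightarrow> i \<in> insert 0 S \<Longrightarrow> card (insert (Suc i) S) \<le> d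
    \<Longrightarrow> reach d (insert (Suc i) S)"
| reach_remove: "reach d (insert (Suc i) S) \<Longrightarrow> i \<in> insert 0 S \<Longrightarrow> reach d S"

text \<open>Placing and removing are inverse moves with the same precondition, so reachability is
  the same on both sides as long as the larger configuration fits.\<close>

lemma reach_insert_iff:
  assumes "i \<in> insert 0 S" "card (insert (Suc i) S) \<le> d"
  shows "reach d (insert (Suc i) S) \<longleftrightarrow> reach d S"
  using assms reach_place reach_remove by blast

lemma reach_finite_card: "reach d S \<Longrightarrow> finite S \<and> card S \<le> d \<and> 0 \<notin> S"
proof (induction rule: reach.induct)
  case (reach_remove i S)
  then show ?case
    by (metis card_mono finite_insert insertCI order_trans subset_insertI)
qed auto

section \<open>Cutting a configuration at a node\<close>

definition lower :: "nat \<Rightarrow> nat set \<Rightarrow> nat set" where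
  "lower m S = {s \<in> S. s \<le> m}"

text \<open>Shifting by \<open>m\<close> turns node \<open>m\<close> into the virtual node
  \<open>0\<close>, so moves beyond \<open>m\<close> are again moves of the game.\<close>

definition upper :: "nat \<Rightarrow> nat set \<Rightarrow> nat set" where
  "upper m S = {s. 0 < s \<and> m + s \<in> S}"

lemma card_lower_upper:
  assumes "finite S"
  shows "card S = card (lower m S) + card (upper m S)"
proof -
  have "S = lower m S \<union> (+) m ` upper m S"
    by (auto simp: lower_def upper_def image_iff) (metis add_diff_inverse_nat
        less_or_eq_imp_le zero_less_diff not_le order_less_imp_not_less)
  moreover have "lower m S \<inter> (+) m ` upper m S = {}"
    by (auto simp: lower_def upper_def)
  moreover have "card ((+) m ` upper m S) = card (upper m S)"
    by (rule card_image) simp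
  ultimately show ?thesis
    by (metis assms card_Un_disjoint finite_Un)
qed

lemma finite_lower_upper:
  assumes "finite S"
  shows "finite (lower m S)" "finite (upper m S)"
proof -
  show "finite (lower m S)" using assms by (simp add: lower_def)
  have "upper m S \<subseteq> (\<lambda>s. s - m) ` S" by (force simp: upper_def image_iff)
  then show "finite (upper m S)" using assms finite_surj by blast
qed

lemma lower_insert: "lower m (insert s S) = (if s \<le> m then insert s (lower m S) else lower m S)"
  by (auto simp: lower_def)

lemma upper_insert: "upper m (insert s S) = (if s \<le> m then upper m S else insert (s - m) (upper m S))"
  by (auto simp: upper_def)

text \<open>While some pebble lies beyond \<open>m\<close>, the lower part uses at most \<open>d\<close> pebbles and was in a
  configuration containing \<open>m\<close> when the crossing took place. By reversibility it therefore never
  becomes reachable from the empty configuration; in particular it never becomes empty, which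
  leaves only \<open>d\<close> pebbles for the upper part.\<close>

lemma reach_split:
  assumes far: "\<And>S. reach d S \<Longrightarrow> m \<notin> S" and "0 < m"
    and "reach (Suc d) S"
  shows "upper m S = {} \<or> \<not> reach d (lower m S) \<and> reach d (upper m S)"
  using assms(3)
proof (induction rule: reach.induct)
  case reach_empty
  then show ?case by (simp add: upper_def)
next
  case (reach_place S i)
  let ?T = "insert (Suc i) S"
  have fin: "finite S" "finite ?T" and c: "card ?T \<le> Suc d"
    using reach_place reach_finite_card by auto
  show ?case
  proof (cases "Suc i \<le> m")
    case True
    then have lu: "lower m ?T = insert (Suc i) (lower m S)" "upper m ?T = upper m S"
      by (simp_all add: lower_insert upper_insert)
    show ?thesis
    proof (cases "upper m S = {}")
      case False
      \<comment> \<open>A pebble beyond \<open>m\<close> leaves at most \<open>d\<close> for the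
        lower part, so the move there is reversible within \<open>d\<close> pebbles.\<close>
      then have "card (upper m S) > 0" using fin finite_lower_upper by (simp add: card_gt_0_iff)
      then have "card (lower m ?T) \<le> d" using c card_lower_upper[OF fin(2), of m] lu by simp
      moreover have "i \<in> insert 0 (lower m S)" using reach_place.hyps True by (auto simp: lower_def)
      ultimately have "reach d (lower m ?T) \<longleftrightarrow> reach d (lower m S)"
        using reach_insert_iff lu by metis
      then show ?thesis using lu reach_place.IH False by auto
    qed (use lu in auto)
  next
    case False
    then have lu: "lower m ?T = lower m S" "upper m ?T = insert (Suc (i - m)) (upper m S)"
      by (auto simp: lower_insert upper_insert Suc_diff_le)
    have up: "i - m \<in> insert 0 (upper m S)" using reach_place.hyps False by (auto simp: upper_def)
    \<comment> \<open>If the new pebble is the only one beyond \<open>m\<close>, it sits on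
      \<open>Suc m\<close>; then \<open>m\<close> itself is pebbled and \<open>far\<close>
      applies.\<close>
    have low: "\<not> reach d (lower m S)"
    proof (cases "upper m S = {}")
      case True
      have "i = m"
      proof (rule ccontr)
        assume "i \<noteq> m"
        then have "i - m \<in> upper m S" using up False by auto
        then show False using True by simp
      qed
      then have "m \<in> lower m S" using reach_place.hyps \<open>0 < m\<close> by (auto simp: lower_def)
      then show ?thesis using far by blast
    qed (use reach_place.IH in auto)
    \<comment> \<open>The empty set is reachable, so an unreachable lower part holds a pebble and at
      most \<open>d\<close> remain beyond \<open>m\<close>.\<close>
    then have "lower m S \<noteq> {}" using reach.reach_empty by metis
    then have "card (lower m S) > 0" using fin finite_lower_upper by (simp add: card_gt_0_iff)
    then have "card (upper m ?T) \<le> d" using c card_lower_upper[OF fin(2), of m] lu by simp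
    moreover have "reach d (upper m S)" using reach_place.IH reach.reach_empty by metis
    ultimately have "reach d (upper m ?T)" using up lu reach.reach_place by metis
    then show ?thesis using low lu by simp
  qed
next
  case (reach_remove i S)
  let ?T = "insert (Suc i) S"
  have fin: "finite S" "finite ?T" and c: "card ?T \<le> Suc d"
    using reach_remove reach_finite_card[of "Suc d" ?T] by auto
  show ?case
  proof (cases "Suc i \<le> m")
    case True
    then have lu: "lower m ?T = insert (Suc i) (lower m S)" "upper m ?T = upper m S"
      by (simp_all add: lower_insert upper_insert)
    show ?thesis
    proof (cases "upper m S = {}")
      case False
      then have "card (upper m S) > 0" using fin finite_lower_upper by (simp add: card_gt_0_iff)
      then have "card (lower m ?T) \<le> d" using c card_lower_upper[OF fin(2), of m] lu by simp
      moreover have "i \<in> insert 0 (lower m S)" using reach_remove.hyps True by (auto simp: lower_def)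
      ultimately have "reach d (lower m ?T) \<longleftrightarrow> reach d (lower m S)"
        using reach_insert_iff lu by metis
      then show ?thesis using lu reach_remove.IH False by auto
    qed auto
  next
    case False
    then have lu: "lower m ?T = lower m S" "upper m ?T = insert (Suc (i - m)) (upper m S)"
      by (auto simp: lower_insert upper_insert Suc_diff_le)
    have up: "i - m \<in> insert 0 (upper m S)" using reach_remove.hyps False by (auto simp: upper_def)
    \<comment> \<open>The upper part of \<open>?T\<close> is nonempty, so the induction hypothesis
      yields both facts for \<open>?T\<close>; the removal changes only the upper part.\<close>
    have "reach d (upper m S)" "\<not> reach d (lower m S)"
      using reach_remove.IH lu up reach.reach_remove by (metis insert_not_empty)+
    then show ?thesis by simp
  qed
qed

text \<open>Cut at \<open>2 ^ d\<close>, which by induction \<open>d\<close> pebbles never reach.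
  The part beyond the cut is a \<open>d\<close>-pebble configuration and extends by less than
  \<open>2 ^ d\<close>, so each extra pebble doubles the range.\<close>

lemma reach_less: "reach d S \<Longrightarrow> s \<in> S \<Longrightarrow> s < 2 ^ d"
proof (induction d arbitrary: S s)
  case 0
  then show ?case using reach_finite_card[of 0 S] by auto
next
  case (Suc d)
  let ?m = "2 ^ d :: nat"
  show ?case
  proof (cases "s \<le> ?m")
    case False
    then have s: "s - ?m \<in> upper ?m S" using Suc.prems by (auto simp: upper_def)
    have "upper ?m S = {} \<or> \<not> reach d (lower ?m S) \<and> reach d (upper ?m S)"
      by (rule reach_split) (use Suc in auto)
    then have "s - ?m < 2 ^ d" using s Suc.IH by blast
    then show ?thesis using False by simp
  qed (simp add: le_less_trans)
qed

section \<open>Degrees and binomial multiples\<close>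

lemma keys_add_expo: "Poly_Mapping.keys (a + b :: expo) = Poly_Mapping.keys a \<union> Poly_Mapping.keys b"
  by (auto simp: in_keys_iff lookup_add)

lemma expo_degree_superset:
  assumes "finite S" "Poly_Mapping.keys m \<subseteq> S"
  shows "expo_degree m = (\<Sum>i\<in>S. Poly_Mapping.lookup m i)"
  unfolding expo_degree_def using assms by (intro sum.mono_neutral_left) (auto simp: in_keys_iff)

lemma expo_degree_add [simp]: "expo_degree (a + b) = expo_degree a + expo_degree b"
proof -
  let ?S = "Poly_Mapping.keys a \<union> Poly_Mapping.keys b"
  have "expo_degree m = (\<Sum>i\<in>?S. Poly_Mapping.lookup m i)" if "m \<in> {a, b, a + b}" for m
    by (rule expo_degree_superset) (use that in \<open>auto simp: keys_add_expo\<close>)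
  then show ?thesis by (simp add: lookup_add sum.distrib)
qed

lemma expo_degree_zero [simp]: "expo_degree 0 = 0"
  by (simp add: expo_degree_def)

lemma expo_degree_single [simp]: "expo_degree (Poly_Mapping.single i k) = k"
  by (simp add: expo_degree_def)

text \<open>Turns a degree bound into a bound on the number of pebbles.\<close>

lemma card_keys_le_expo_degree: "card (Poly_Mapping.keys m) \<le> expo_degree m"
proof -
  have "(\<Sum>i\<in>Poly_Mapping.keys m. 1) \<le> expo_degree m"
    unfolding expo_degree_def by (rule sum_mono) (simp add: in_keys_iff Suc_le_eq)
  then show ?thesis by simp
qed

lemma expo_degree_le_total_degree:
  "m \<in> Poly_Mapping.keys p \<Longrightarrow> expo_degree m \<le> total_degree p"
  unfolding total_degree_def by (rule Max_ge) auto

lemma total_degree_leI: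
  "(\<And>m. m \<in> Poly_Mapping.keys p \<Longrightarrow> expo_degree m \<le> d) \<Longrightarrow> total_degree p \<le> d"
  unfolding total_degree_def by (subst Max_le_iff) auto

lemma monomial_mult: "monomial a * monomial b = (monomial (a + b) :: 'a::comm_ring_1 mpoly)"
  by (simp add: monomial_def mult_single)

lemma monomial_zero [simp]: "monomial 0 = (1 :: 'a::comm_ring_1 mpoly)"
  by (simp add: monomial_def)

lemma lookup_monomial_mult [simp]:
  "Poly_Mapping.lookup (monomial a * g) (a + m) = Poly_Mapping.lookup (g :: 'a::comm_ring_1 mpoly) m"
  by (simp add: lookup_mult monomial_def lookup_single when_mult)

lemma keys_monomial_mult:
  "Poly_Mapping.keys (monomial a * g) = (+) a ` Poly_Mapping.keys (g :: 'a::comm_ring_1 mpoly)"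
proof
  show "Poly_Mapping.keys (monomial a * g) \<subseteq> (+) a ` Poly_Mapping.keys g"
    using keys_mult[of "monomial a" g] by (auto simp: monomial_def split: if_splits)
qed (auto simp: in_keys_iff)

text \<open>A monomial of \<open>g\<close> of maximal degree, shifted by \<open>b\<close>, cannot cancel against a shift by
  the smaller \<open>a\<close>.\<close>

lemma total_degree_binomial_mult_ge:
  fixes g :: "'a::comm_ring_1 mpoly"
  assumes "expo_degree a < expo_degree b" "m \<in> Poly_Mapping.keys g"
  shows "expo_degree (b + m) \<le> total_degree ((monomial a - monomial b) * g)"
proof -
  have "Max (expo_degree ` Poly_Mapping.keys g) \<in> expo_degree ` Poly_Mapping.keys g"
    using assms(2) by (intro Max_in) auto
  then obtain k where k: "k \<in> Poly_Mapping.keys g"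
      "expo_degree k = Max (expo_degree ` Poly_Mapping.keys g)" by auto
  then have top: "expo_degree l \<le> expo_degree k" if "l \<in> Poly_Mapping.keys g" for l
    using that by simp
  have "b + k \<notin> Poly_Mapping.keys (monomial a * g)"
  proof
    assume "b + k \<in> Poly_Mapping.keys (monomial a * g)"
    then obtain l where l: "l \<in> Poly_Mapping.keys g" "b + k = a + l"
      by (auto simp: keys_monomial_mult)
    then have "expo_degree b + expo_degree k = expo_degree a + expo_degree l"
      by (metis expo_degree_add)
    then show False using top[OF l(1)] assms(1) by simp
  qed
  then have "b + k \<in> Poly_Mapping.keys ((monomial a - monomial b) * g)"
    using k(1) by (simp add: in_keys_iff left_diff_distrib lookup_minus)
  then have "expo_degree (b + k) \<le> total_degree ((monomial a - monomial b) * g)"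
    by (rule expo_degree_le_total_degree)
  then show ?thesis using top[OF assms(2)] by simp
qed

section \<open>Linear functionals given by a predicate on monomials\<close>

definition coeff_sum :: "(expo \<Rightarrow> bool) \<Rightarrow> 'a::comm_ring_1 mpoly \<Rightarrow> 'a" where
  "coeff_sum R p = (\<Sum>m\<in>Poly_Mapping.keys p. if R m then Poly_Mapping.lookup p m else 0)"

lemma coeff_sum_zero [simp]: "coeff_sum R 0 = 0"
  by (simp add: coeff_sum_def)

lemma coeff_sum_one [simp]: "coeff_sum R 1 = (if R 0 then 1 else 0)"
  by (simp add: coeff_sum_def lookup_one)

lemma coeff_sum_add: "coeff_sum R (p + q) = coeff_sum R p + coeff_sum R q"
  unfolding coeff_sum_def by (rule setsum_keys_plus_distrib) auto

lemma coeff_sum_diff: "coeff_sum R (p - q) = coeff_sum R p - coeff_sum R q"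
  using coeff_sum_add[of R "p - q" q] by simp

lemma coeff_sum_sum: "coeff_sum R (\<Sum>x\<in>X. f x) = (\<Sum>x\<in>X. coeff_sum R (f x))"
  by (induction X rule: infinite_finite_induct) (simp_all add: coeff_sum_add)

lemma coeff_sum_monomial_mult:
  "coeff_sum R (monomial a * g) = coeff_sum (\<lambda>m. R (a + m)) g"
proof -
  have "coeff_sum R (monomial a * g) = (\<Sum>m\<in>Poly_Mapping.keys g.
      if R (a + m) then Poly_Mapping.lookup (monomial a * g) (a + m) else 0)"
    by (simp add: coeff_sum_def keys_monomial_mult sum.reindex)
  then show ?thesis by (simp only: coeff_sum_def lookup_monomial_mult)
qed

lemma coeff_sum_cong:
  "(\<And>m. m \<in> Poly_Mapping.keys p \<Longrightarrow> R m = Q m) \<Longrightarrow> coeff_sum R p = coeff_sum Q p"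
  unfolding coeff_sum_def by (rule sum.cong) auto

text \<open>Each term of \<open>g\<close> is counted with a plus sign at \<open>a + m\<close> and a
  minus sign at \<open>b + m\<close>; when \<open>R\<close> agrees on the two, they cancel.\<close>

lemma coeff_sum_binomial_mult:
  assumes "\<And>m. m \<in> Poly_Mapping.keys g \<Longrightarrow> R (a + m) = R (b + m)"
  shows "coeff_sum R ((monomial a - monomial b) * g) = 0"
  using coeff_sum_cong[of g "\<lambda>m. R (a + m)" "\<lambda>m. R (b + m)"] assms
  by (simp add: left_diff_distrib coeff_sum_diff coeff_sum_monomial_mult)

section \<open>The induction principle and its Nullstellensatz degree\<close>

text \<open>Node \<open>0\<close> is not a variable but the constant \<open>1\<close>, so that the unit clause \<open>x\<^sub>1\<close> becomes the
  implication step from node \<open>0\<close> to node \<open>1\<close>.\<close>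

definition node_expo :: "nat \<Rightarrow> expo" where
  "node_expo i = (if i = 0 then 0 else Poly_Mapping.single i 1)"

definition step_clause :: "nat \<Rightarrow> clause" where
  "step_clause i = ({Suc i}, {i} - {0})"

definition induction_cnf :: "nat \<Rightarrow> cnf" where
  "induction_cnf n = insert ({}, {Suc n}) (step_clause ` {..n})"

lemma keys_node_expo: "Poly_Mapping.keys (node_expo i) = {i} - {0}"
  by (auto simp: node_expo_def)

lemma is_cnf_induction_cnf: "is_cnf (induction_cnf n)"
  by (auto simp: is_cnf_def induction_cnf_def step_clause_def)

lemma cnf_vars_induction_cnf: "cnf_vars (induction_cnf n) = {1..Suc n}"
proof -
  have "cnf_vars (induction_cnf n) = insert (Suc n) (\<Union>i\<le>n. insert (Suc i) ({i} - {0}))"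
    by (auto simp: cnf_vars_def induction_cnf_def step_clause_def)
  also have "\<dots> = {1..Suc n}"
  proof
    show "{1..Suc n} \<subseteq> insert (Suc n) (\<Union>i\<le>n. insert (Suc i) ({i} - {0}))"
    proof
      fix x assume "x \<in> {1..Suc n}"
      then show "x \<in> insert (Suc n) (\<Union>i\<le>n. insert (Suc i) ({i} - {0}))"
        by (cases x) auto
    qed
  qed auto
  finally show ?thesis .
qed

lemma unsatisfiable_induction_cnf: "unsatisfiable (induction_cnf n)"
  unfolding unsatisfiable_def
proof
  assume "\<exists>\<tau>. \<forall>C\<in>induction_cnf n. sat_clause \<tau> C"
  then obtain \<tau> where sat: "\<forall>C\<in>induction_cnf n. sat_clause \<tau> C" by blast
  have "\<tau> (Suc i)" if "i \<le> n" for i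
    using that
  proof (induction i)
    case (Suc i)
    have "sat_clause \<tau> (step_clause (Suc i))" using sat Suc by (auto simp: induction_cnf_def)
    then show ?case using Suc by (auto simp: sat_clause_def step_clause_def)
  next
    case 0
    have "sat_clause \<tau> (step_clause 0)" using sat by (auto simp: induction_cnf_def)
    then show ?case by (auto simp: sat_clause_def step_clause_def)
  qed
  moreover have "\<not> \<tau> (Suc n)" using sat by (auto simp: induction_cnf_def sat_clause_def)
  ultimately show False by blast
qed

lemma prod_Var_node: "(\<Prod>y\<in>{i} - {0}. Var y) = (monomial (node_expo i) :: 'a::comm_ring_1 mpoly)"
  by (cases "i = 0") (simp_all add: node_expo_def Var_def)

lemma enc_step_clause:
  "enc_clause (step_clause i) =
    (monomial (node_expo i) - monomial (node_expo i + node_expo (Suc i)) :: 'a::comm_ring_1 mpoly)"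
proof -
  have "enc_clause (step_clause i) = (1 - Var (Suc i)) * (monomial (node_expo i) :: 'a mpoly)"
    by (simp add: enc_clause_def step_clause_def prod_Var_node)
  also have "Var (Suc i) = (monomial (node_expo (Suc i)) :: 'a mpoly)"
    by (simp add: Var_def node_expo_def)
  finally show ?thesis
    by (simp add: left_diff_distrib monomial_mult add.commute)
qed

lemma enc_last_clause:
  "enc_clause ({}, {Suc n}) = (monomial (node_expo (Suc n)) :: 'a::comm_ring_1 mpoly)"
  by (simp add: enc_clause_def node_expo_def Var_def)

lemma bool_axiom_binomial:
  "bool_axiom i = (monomial (Poly_Mapping.single i 2) - monomial (Poly_Mapping.single i 1)
    :: 'a::comm_ring_1 mpoly)"
proof -
  have "Poly_Mapping.single i 1 + Poly_Mapping.single i 1 = (Poly_Mapping.single i 2 :: expo)"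
    by (metis one_add_one single_add)
  then show ?thesis by (simp only: bool_axiom_def Var_def power2_eq_square monomial_mult)
qed

lemma coeff_sum_step_clause_mult:
  fixes g :: "'a::comm_ring_1 mpoly"
  assumes "total_degree (enc_clause (step_clause i) * g) \<le> d"
  shows "coeff_sum (\<lambda>m. reach d (Poly_Mapping.keys m)) (enc_clause (step_clause i) * g) = 0"
  unfolding enc_step_clause
proof (rule coeff_sum_binomial_mult)
  let ?b = "node_expo i + node_expo (Suc i)"
  fix m assume m: "m \<in> Poly_Mapping.keys g"
  \<comment> \<open>The degree bound on the product reaches the larger monomial, so even the
    configuration with the extra pebble fits.\<close>
  have "expo_degree (?b + m) \<le> d"
    using total_degree_binomial_mult_ge[OF _ m, of "node_expo i" ?b] assms
    by (simp add: enc_step_clause) (simp add: node_expo_def)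
  then have "card (Poly_Mapping.keys (?b + m)) \<le> d"
    using card_keys_le_expo_degree order_trans by blast
  moreover have "Poly_Mapping.keys (?b + m) = insert (Suc i) (Poly_Mapping.keys (node_expo i + m))"
    by (auto simp: keys_add_expo keys_node_expo)
  moreover have "i \<in> insert 0 (Poly_Mapping.keys (node_expo i + m))"
    by (auto simp: keys_add_expo keys_node_expo)
  ultimately show "reach d (Poly_Mapping.keys (node_expo i + m)) =
      reach d (Poly_Mapping.keys (?b + m))"
    by (simp only: reach_insert_iff)
qed

text \<open>Squaring a variable leaves the set of variables unchanged, so the two monomials describe
  the same configuration.\<close>

lemma coeff_sum_bool_axiom_mult:
  fixes g :: "'a::comm_ring_1 mpoly"
  shows "coeff_sum (\<lambda>m. reach d (Poly_Mapping.keys m)) (g * bool_axiom i) = 0"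
  unfolding bool_axiom_binomial mult.commute[of g]
  by (rule coeff_sum_binomial_mult) (simp add: keys_add_expo)

lemma ns_degree_induction_cnf:
  fixes g :: "'a::field mpoly \<Rightarrow> 'a mpoly"
  assumes "ns_refutation (cnf_vars (induction_cnf n)) (enc_cnf (induction_cnf n)) g h"
  shows "n < 2 ^ ns_degree (cnf_vars (induction_cnf n)) (enc_cnf (induction_cnf n)) g h"
    (is "n < 2 ^ ?d")
proof (rule ccontr)
  let ?V = "cnf_vars (induction_cnf n)" and ?A = "enc_cnf (induction_cnf n) :: 'a mpoly set"
  let ?L = "coeff_sum (\<lambda>m. reach ?d (Poly_Mapping.keys m)) :: 'a mpoly \<Rightarrow> 'a"
  assume "\<not> n < 2 ^ ?d"
  then have unreach: "Suc n \<notin> S" if "reach ?d S" for S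
    using reach_less[OF that, of "Suc n"] by auto
  have fin: "finite ?V" "finite ?A"
    unfolding cnf_vars_induction_cnf by (simp_all add: enc_cnf_def induction_cnf_def)
  \<comment> \<open>The degree bounds each product separately, before any cancellation in the
    sum.\<close>
  have deg: "total_degree (p * g p) \<le> ?d" if "p \<in> ?A" for p
    unfolding ns_degree_def using that fin by (intro Max_ge) auto
  have "?L (p * g p) = 0" if p: "p \<in> ?A" for p
  proof -
    consider "p = enc_clause ({}, {Suc n})" | i where "p = enc_clause (step_clause i)"
      using p by (auto simp: enc_cnf_def induction_cnf_def)
    then show ?thesis
    proof cases
      case 1
      have "\<not> reach ?d (Poly_Mapping.keys (node_expo (Suc n) + m))" for m
        using unreach by (auto simp: keys_add_expo keys_node_expo)
      then show ?thesis
        unfolding 1 enc_last_clause coeff_sum_monomial_mult by (simp add: coeff_sum_def)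
    next
      case 2
      then show ?thesis using deg[OF p] coeff_sum_step_clause_mult by blast
    qed
  qed
  then have "?L ((\<Sum>p\<in>?A. p * g p) + (\<Sum>i\<in>?V. h i * bool_axiom i)) = 0"
    by (simp add: coeff_sum_add coeff_sum_sum coeff_sum_bool_axiom_mult)
  moreover have "?L 1 = 1" by (simp add: reach_empty)
  ultimately show False using assms by (simp add: ns_refutation_def)
qed

section \<open>A Monomial Calculus refutation\<close>

text \<open>Premises are drawn from a set instead of by index, so that derivations can grow by
  appending.\<close>

definition mc_step :: "nat set \<Rightarrow> 'a::field mpoly set \<Rightarrow> 'a mpoly set \<Rightarrow> 'a mpoly \<Rightarrow> bool" where
  "mc_step V A Q p \<longleftrightarrow> p \<in> mc_axioms V A \<or>
     (\<exists>q\<in>Q. \<exists>r\<in>Q. \<exists>\<alpha> \<beta>. p = Const \<alpha> * q + Const \<beta> * r) \<or>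
     (\<exists>q\<in>Q. \<exists>v\<in>V. mc_multipliable V A q \<and> p = Var v * q)"

inductive mc_seq :: "nat set \<Rightarrow> 'a::field mpoly set \<Rightarrow> 'a mpoly list \<Rightarrow> bool" for V A where
  mc_seq_Nil: "mc_seq V A []"
| mc_seq_snoc: "mc_seq V A ps \<Longrightarrow> mc_step V A (set ps) p \<Longrightarrow> total_degree p \<le> 2
    \<Longrightarrow> mc_seq V A (ps @ [p])"

lemma mc_seq_total_degree: "mc_seq V A ps \<Longrightarrow> p \<in> set ps \<Longrightarrow> total_degree p \<le> 2"
  by (induction rule: mc_seq.induct) auto

lemma mc_seq_refutation:
  assumes "mc_seq V A ps" "ps \<noteq> []" "last ps = 1"
  shows "mc_refutation V A ps"
proof -
  have "\<forall>k < length ps. mc_step V A (set (take k ps)) (ps ! k)"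
    using assms(1) by (induction rule: mc_seq.induct) (auto simp: nth_append less_Suc_eq)
  moreover have "set (take k ps) = {ps ! i | i. i < k}" if "k < length ps" for k
    using that by (auto simp: in_set_conv_nth) force+
  ultimately show ?thesis
    using assms(2,3) unfolding mc_refutation_def mc_step_def by fastforce
qed

lemma total_degree_monomial_le: "expo_degree a \<le> d \<Longrightarrow> total_degree (monomial a) \<le> d"
  by (rule total_degree_leI) (auto simp: monomial_def split: if_splits)

lemma total_degree_binomial_le:
  assumes "expo_degree a \<le> d" "expo_degree b \<le> d"
  shows "total_degree (monomial a - monomial b) \<le> d"
proof (rule total_degree_leI)
  fix m assume "m \<in> Poly_Mapping.keys (monomial a - monomial b)"
  then have "m = a \<or> m = b"
    by (auto simp: in_keys_iff lookup_minus monomial_def lookup_single when_def split: if_splits)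
  then show "expo_degree m \<le> d" using assms by auto
qed

lemma expo_degree_node_expo: "expo_degree (node_expo i) \<le> 1"
  by (simp add: node_expo_def)

lemma mc_refutation_induction_cnf:
  "\<exists>ps :: 'a::field mpoly list.
     mc_refutation (cnf_vars (induction_cnf n)) (enc_cnf (induction_cnf n)) ps \<and> mc_degree ps = 2"
proof -
  let ?V = "cnf_vars (induction_cnf n)" and ?A = "enc_cnf (induction_cnf n) :: 'a mpoly set"
  let ?x = "\<lambda>i. monomial (node_expo i) :: 'a mpoly"
  have V: "1 \<in> ?V" by (simp add: cnf_vars_induction_cnf)
  \<comment> \<open>Downward induction from \<open>Suc n\<close> to node \<open>0\<close>, whose
    monomial is \<open>1\<close>. The Boolean axiom makes the degree exactly 2 even for
    \<open>n = 0\<close>, where the other lines are linear.\<close>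
  have "\<exists>ps. mc_seq ?V ?A ps \<and> bool_axiom 1 \<in> set ps \<and> ps \<noteq> [] \<and> last ps = ?x i"
    if "i \<le> Suc n" for i
    using that
  proof (induction rule: inc_induct)
    case base
    have "mc_seq ?V ?A [bool_axiom 1]"
      using mc_seq_snoc[OF mc_seq_Nil, of ?V ?A "bool_axiom 1"] V
      by (simp add: mc_step_def mc_axioms_def bool_axiom_binomial total_degree_binomial_le)
    moreover have "?x (Suc n) \<in> ?A"
      by (metis enc_cnf_def enc_last_clause image_eqI induction_cnf_def insertI1)
    ultimately have "mc_seq ?V ?A ([bool_axiom 1] @ [?x (Suc n)])"
      using expo_degree_node_expo[of "Suc n"]
      by (intro mc_seq_snoc) (auto simp: mc_step_def mc_axioms_def intro!: total_degree_monomial_le)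
    then show ?case by (intro exI[of _ "[bool_axiom 1, ?x (Suc n)]"]) simp
  next
    case (step i)
    then obtain ps where ps: "mc_seq ?V ?A ps" "bool_axiom 1 \<in> set ps" "ps \<noteq> []"
      "last ps = ?x (Suc i)" by blast
    have x: "?x (Suc i) \<in> set ps" using ps by (metis last_in_set)
    let ?y = "monomial (node_expo i + node_expo (Suc i)) :: 'a mpoly"
    let ?c = "enc_clause (step_clause i) :: 'a mpoly"
    have deg: "total_degree ?y \<le> 2" "total_degree ?c \<le> 2" "total_degree (?x i) \<le> 2"
      using expo_degree_node_expo[of i] expo_degree_node_expo[of "Suc i"] unfolding enc_step_clause
      by (auto intro!: total_degree_monomial_le total_degree_binomial_le)
    have "mc_step ?V ?A (set ps) ?y"
    proof (cases "i = 0")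
      case True
      \<comment> \<open>Node \<open>0\<close> is the constant \<open>1\<close>, so \<open>?y\<close>
        is the previous line, repeated as a trivial linear combination.\<close>
      have "?y = Const 1 * ?x (Suc i) + Const 0 * ?x (Suc i)"
        using True by (simp add: node_expo_def Const_def)
      then show ?thesis using x unfolding mc_step_def by blast
    next
      case False
      then have "?y = Var i * ?x (Suc i)" by (simp add: node_expo_def Var_def monomial_mult)
      moreover have "mc_multipliable ?V ?A (?x (Suc i))"
        using step.hyps unfolding mc_multipliable_def
        by (intro exI[of _ "node_expo (Suc i)"]) (simp add: keys_node_expo cnf_vars_induction_cnf)
      moreover have "i \<in> ?V" using False step.hyps by (simp add: cnf_vars_induction_cnf)
      ultimately show ?thesis using x unfolding mc_step_def by meson
    qed
    with ps(1) have 1: "mc_seq ?V ?A (ps @ [?y])" using deg(1) by (rule mc_seq_snoc)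
    have "?c \<in> ?A" using step.hyps by (auto simp: enc_cnf_def induction_cnf_def)
    then have "mc_step ?V ?A (set (ps @ [?y])) ?c" by (simp add: mc_step_def mc_axioms_def)
    with 1 have "mc_seq ?V ?A ((ps @ [?y]) @ [?c])" using deg(2) by (rule mc_seq_snoc)
    moreover have "mc_step ?V ?A (set ((ps @ [?y]) @ [?c])) (?x i)"
    proof -
      have "?x i = Const 1 * ?y + Const 1 * ?c" by (simp add: enc_step_clause Const_def)
      moreover have "?y \<in> set ((ps @ [?y]) @ [?c])" "?c \<in> set ((ps @ [?y]) @ [?c])" by auto
      ultimately show ?thesis unfolding mc_step_def by blast
    qed
    ultimately have "mc_seq ?V ?A (((ps @ [?y]) @ [?c]) @ [?x i])"
      using deg(3) by (rule mc_seq_snoc)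
    then show ?case using ps(2) by (intro exI[of _ "((ps @ [?y]) @ [?c]) @ [?x i]"]) simp
  qed
  from this[of 0] obtain ps where ps: "mc_seq ?V ?A ps" "bool_axiom 1 \<in> set ps" "ps \<noteq> []"
    "last ps = 1" by (auto simp: node_expo_def)
  have "Poly_Mapping.single 1 2 \<in> Poly_Mapping.keys (bool_axiom 1 :: 'a mpoly)"
  proof -
    have "Poly_Mapping.single 1 1 \<noteq> (Poly_Mapping.single 1 2 :: expo)"
      by (metis expo_degree_single one_eq_numeral_iff semiring_norm(85))
    then show ?thesis
      by (simp add: bool_axiom_binomial in_keys_iff lookup_minus monomial_def lookup_single_not_eq)
  qed
  then have "2 \<le> total_degree (bool_axiom 1 :: 'a mpoly)"
    using expo_degree_le_total_degree by fastforce
  then have "total_degree (bool_axiom 1 :: 'a mpoly) = 2"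
    using mc_seq_total_degree[OF ps(1,2)] by simp
  then have "mc_degree ps = 2"
    unfolding mc_degree_def using mc_seq_total_degree[OF ps(1)]
    by (intro Max_eqI) (auto intro: rev_image_eqI[OF ps(2)])
  then show ?thesis using mc_seq_refutation ps by blast
qed

theorem theorem3p9:
  shows "\<exists>F :: nat \<Rightarrow> cnf.
    (\<forall>n. is_cnf (F n) \<and> unsatisfiable (F n)) \<and>
    (\<lambda>n. real (card (cnf_vars (F n)))) \<in> \<Theta>(\<lambda>n. real n) \<and>
    (\<forall>n.
      (\<exists>ps :: 'a::field mpoly list.
          mc_refutation (cnf_vars (F n)) (enc_cnf (F n)) ps \<and> mc_degree ps = 2) \<and>
      (\<forall>(g :: 'a mpoly \<Rightarrow> 'a mpoly) (h :: nat \<Rightarrow> 'a mpoly).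
          ns_refutation (cnf_vars (F n)) (enc_cnf (F n)) g h \<longrightarrow>
          \<lceil>log 2 (real n)\<rceil> \<le> int (ns_degree (cnf_vars (F n)) (enc_cnf (F n)) g h)))"
proof (intro exI[of _ induction_cnf] conjI allI impI)
  show "(\<lambda>n. real (card (cnf_vars (induction_cnf n)))) \<in> \<Theta>(\<lambda>n. real n)"
  proof (rule bigthetaI)
    show "(\<lambda>n. real (card (cnf_vars (induction_cnf n)))) \<in> O(\<lambda>n. real n)"
      by (rule bigoI[of _ 2], rule eventually_sequentiallyI[of 1])
        (simp add: cnf_vars_induction_cnf)
    show "(\<lambda>n. real (card (cnf_vars (induction_cnf n)))) \<in> \<Omega>(\<lambda>n. real n)"
      by (rule landau_omega.bigI[of 1]) (auto simp: cnf_vars_induction_cnf)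
  qed
next
  fix n :: nat and g :: "'a mpoly \<Rightarrow> 'a mpoly" and h :: "nat \<Rightarrow> 'a mpoly"
  assume ref: "ns_refutation (cnf_vars (induction_cnf n)) (enc_cnf (induction_cnf n)) g h"
  let ?d = "ns_degree (cnf_vars (induction_cnf n)) (enc_cnf (induction_cnf n)) g h"
  have "log 2 (real n) \<le> real ?d"
  \<comment> \<open>For \<open>n = 0\<close> the convention \<open>ln 0 = 0\<close> makes the
    logarithm zero.\<close>
  proof (cases "n = 0")
    case False
    have "real n < 2 ^ ?d" using ns_degree_induction_cnf[OF ref]
      by (metis of_nat_less_iff of_nat_numeral of_nat_power)
    then have "log 2 (real n) \<le> log 2 (2 ^ ?d)" using False by (subst log_le_cancel_iff) auto
    then show ?thesis by (simp add: log_nat_power)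
  qed (simp add: log_def)
  then show "\<lceil>log 2 (real n)\<rceil> \<le> int ?d" by (simp add: ceiling_le_iff)
qed (rule is_cnf_induction_cnf unsatisfiable_induction_cnf mc_refutation_induction_cnf)+

end
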